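(* Let $u$ be a classical solution on $\mathbb{R}$ of the Whitham equation $u_t+2uu_x+K*u_x=0$, $(t,x)\in[0,\infty)\times\mathbb{R}$. Suppose that $u$ is symmetric, i.e. there exists a function $\lambda\in C^1([0,\infty))$ such that $u(t,x)=u(t,2\lambda(t)-x)$ for every $t\ge 0$ and $x\in\mathbb{R}$, and that $u$ is unique with respect to its initial data, i.e. any classical solution of the Whitham equation with the same initial data as $u$ coincides with $u$. Then $u$ is a traveling-wave solution: there exist $c\in\mathbb{R}$ and a function $\phi:\mathbb{R}\to\mathbb{R}$ such that $u(t,x)=\phi(x-ct)$ for all $(t,x)\in[0,\infty)\times\mathbb{R}$.
   Context: The kernel is $K=\mathcal{F}^{-1}(m)\in L_1(\mathbb{R})$, where $m(\xi)=\left(\frac{\tanh\xi}{\xi}\right)^{1/2}$ (with $m(0)=1$) and $\mathcal{F}(f)(\xi)=\int_{\mathbb{R}}f(x)e^{-ix\xi}\,dx$; $K$ is even, and the convolution is in the spatial variable $x$. A classical solution is a real-valued function $u\in C^1([0,\infty)\times\mathbb{R})$ for which the convolution $K*u_x$ is given by an absolutely convergent integral at every $(t,x)$ and which satisfies the equation pointwise for all $(t,x)\in[0,\infty)\times\mathbb{R}$. *)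

theory Defs
  imports "HOL-Analysis.Analysis"
begin

definition fourier_transform :: "(real \<Rightarrow> complex) \<Rightarrow> real \<Rightarrow> complex" where
  "fourier_transform f \<xi> = (\<integral>x. f x * exp (- (\<i> * of_real (x * \<xi>))) \<partial>lborel)"

definition whitham_symbol :: "real \<Rightarrow> real" where
  "whitham_symbol \<xi> = (if \<xi> = 0 then 1 else sqrt (tanh \<xi> / \<xi>))"

text \<open>
  The symbol decays only like \<open>\<bar>\<xi>\<bar> powr (-1/2)\<close> and is not integrable, so its inverse transform
  is not an absolutely convergent integral. The kernel is instead described as an
  integrable function whose Fourier transform is the symbol. This determines it up to
  null sets, which do not affect convolutions with it.
\<close>

definition whitham_kernel :: "(real \<Rightarrow> real) \<Rightarrow> bool" where
  "whitham_kernel K \<longleftrightarrow> integrable lborel K \<and>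
     (\<forall>\<xi>. fourier_transform (\<lambda>x. complex_of_real (K x)) \<xi> = complex_of_real (whitham_symbol \<xi>))"

definition convolution_exists_at :: "(real \<Rightarrow> real) \<Rightarrow> (real \<Rightarrow> real) \<Rightarrow> real \<Rightarrow> bool" where
  "convolution_exists_at f g x \<longleftrightarrow> integrable lborel (\<lambda>y. f (x - y) * g y)"

definition convolution :: "(real \<Rightarrow> real) \<Rightarrow> (real \<Rightarrow> real) \<Rightarrow> real \<Rightarrow> real" where
  "convolution f g x = (\<integral>y. f (x - y) * g y \<partial>lborel)"

text \<open>
  Derivatives are taken within \<open>S\<close>, hence one-sided at boundary points. The library's
  \<open>C1_differentiable_on\<close> uses two-sided derivatives and functions of one real variable only.
\<close>

definition C1_on :: "'a::real_normed_vector set \<Rightarrow> ('a \<Rightarrow> 'b::real_normed_vector) \<Rightarrow> bool" where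
  "C1_on S f \<longleftrightarrow> (\<exists>D :: 'a \<Rightarrow> 'a \<Rightarrow>\<^sub>L 'b.
     (\<forall>z\<in>S. (f has_derivative blinfun_apply (D z)) (at z within S)) \<and> continuous_on S D)"

text \<open>Functions of \<open>(t, x)\<close> matter only for \<open>t \<ge> 0\<close>; the time derivative at \<open>t = 0\<close> is one-sided.\<close>

definition time_deriv :: "(real \<times> real \<Rightarrow> real) \<Rightarrow> real \<Rightarrow> real \<Rightarrow> real" where
  "time_deriv u t x = vector_derivative (\<lambda>s. u (s, x)) (at t within {0..})"

definition space_deriv :: "(real \<times> real \<Rightarrow> real) \<Rightarrow> real \<Rightarrow> real \<Rightarrow> real" where
  "space_deriv u t x = deriv (\<lambda>y. u (t, y)) x"

definition classical_solution :: "(real \<Rightarrow> real) \<Rightarrow> (real \<times> real \<Rightarrow> real) \<Rightarrow> bool" where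
  "classical_solution K u \<longleftrightarrow>
     C1_on ({0..} \<times> UNIV) u \<and>
     (\<forall>t\<ge>0. \<forall>x. convolution_exists_at K (space_deriv u t) x) \<and>
     (\<forall>t\<ge>0. \<forall>x. time_deriv u t x + 2 * u (t, x) * space_deriv u t x
                  + convolution K (space_deriv u t) x = 0)"

end

theory Submission
  imports "HOL-Probability.Levy" Defs
begin

text \<open>
  Differentiating the symmetry relation in time and using that \<open>K\<close> is even, one compares the
  equation at \<open>x\<close> with the equation at the reflected point \<open>2 \<lambda>(t) - x\<close> and finds
  \<open>2 u u\<^sub>x + K * u\<^sub>x = \<lambda>'(t) u\<^sub>x\<close>. At time \<open>0\<close> this says precisely that the translate of the initial
  profile with speed \<open>c = \<lambda>'(0)\<close> solves the equation, so uniqueness identifies it with \<open>u\<close>.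
  Evenness of \<open>K\<close> is Fourier uniqueness in \<open>L\<^sub>1\<close>, which is reduced to Levy's uniqueness theorem for
  probability measures by splitting into nonnegative parts.
\<close>

section \<open>Uniqueness of the Fourier transform on integrable real functions\<close>

lemma fourier_transform_of_real_diff:
  fixes f g :: "real \<Rightarrow> real"
  assumes "integrable lborel f" "integrable lborel g"
  shows "fourier_transform (\<lambda>x. of_real (f x - g x)) \<xi> =
    fourier_transform (\<lambda>x. of_real (f x)) \<xi> - fourier_transform (\<lambda>x. of_real (g x)) \<xi>"
proof -
  have "integrable lborel (\<lambda>x. complex_of_real (h x) * exp (- (\<i> * of_real (x * \<xi>))))"
    if "integrable lborel h" for h :: "real \<Rightarrow> real"
    by (rule Bochner_Integration.integrable_bound[OF that])
      (use that[THEN borel_measurable_integrable] in \<open>auto simp: norm_mult norm_exp_eq_Re\<close>)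
  from this[OF assms(1)] this[OF assms(2)] show ?thesis
    unfolding fourier_transform_def by (simp add: left_diff_distrib)
qed

lemma fourier_transform_at_0:
  "fourier_transform (\<lambda>x. complex_of_real (f x)) 0 = of_real (integral\<^sup>L lborel f)"
  by (simp add: fourier_transform_def)

text \<open>Bridge to probability theory: \<open>char\<close> integrates
  \<open>exp (\<i> * t * x)\<close>, the opposite sign convention, hence the argument
  \<open>- t\<close>.\<close>

lemma fourier_transform_eq_char:
  assumes f: "f \<in> borel_measurable borel" "\<And>x. 0 \<le> f x"
  shows "char (density lborel (\<lambda>x. ennreal (f x))) t =
    fourier_transform (\<lambda>x. complex_of_real (f x)) (- t)"
  unfolding char_def fourier_transform_def using f
  by (subst integral_density) (auto simp: scaleR_conv_of_real mult.commute)

lemma real_distribution_density: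
  assumes [measurable]: "integrable lborel f" and "\<And>x. 0 \<le> f x" "integral\<^sup>L lborel f = 1"
  shows "real_distribution (density lborel (\<lambda>x. ennreal (f x)))"
proof (intro real_distribution.intro prob_spaceI real_distribution_axioms.intro)
  show "emeasure (density lborel (\<lambda>x. ennreal (f x)))
      (space (density lborel (\<lambda>x. ennreal (f x)))) = 1"
    using assms by (simp add: emeasure_density nn_integral_eq_integral)
qed simp

text \<open>The transforms at frequency 0 give both functions the same integral \<open>I\<close>.
  Dividing by \<open>I\<close> yields probability densities with equal characteristic functions, so
  Levy's theorem identifies the measures and therefore the densities almost everywhere.\<close>

lemma fourier_transform_unique_nonneg:
  fixes f g :: "real \<Rightarrow> real"
  assumes f: "integrable lborel f" "\<And>x. 0 \<le> f x" and g: "integrable lborel g" "\<And>x. 0 \<le> g x"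
    and eq: "\<And>\<xi>. fourier_transform (\<lambda>x. of_real (f x)) \<xi> = fourier_transform (\<lambda>x. of_real (g x)) \<xi>"
  shows "AE x in lborel. f x = g x"
proof -
  define I where "I = integral\<^sup>L lborel f"
  have Ig: "I = integral\<^sup>L lborel g"
    using eq[of 0] by (simp add: fourier_transform_at_0 I_def)
  show ?thesis
  proof (cases "I = 0")
    \<comment> \<open>Normalisation is impossible here, but a nonnegative function with zero
      integral vanishes almost everywhere.\<close>
    case True
    then have "AE x in lborel. f x = 0" "AE x in lborel. g x = 0"
      using Ig I_def integral_nonneg_eq_0_iff_AE f g by (metis (mono_tags) AE_I2)+
    then show ?thesis by eventually_elim simp
  next
    case False
    then have "I > 0" using f unfolding I_def by (metis Bochner_Integration.integral_nonneg order_le_less)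
    define p q where "p = (\<lambda>x. f x / I)" and "q = (\<lambda>x. g x / I)"
    have p: "integrable lborel p" "\<And>x. 0 \<le> p x" "integral\<^sup>L lborel p = 1"
      using f \<open>I > 0\<close> by (auto simp: p_def) (simp add: I_def)
    have q: "integrable lborel q" "\<And>x. 0 \<le> q x" "integral\<^sup>L lborel q = 1"
      using g \<open>I > 0\<close> by (auto simp: q_def Ig)
    have [measurable]: "p \<in> borel_measurable borel" "q \<in> borel_measurable borel"
      using p(1) q(1) by auto
    have "fourier_transform (\<lambda>x. of_real (p x)) \<xi> = fourier_transform (\<lambda>x. of_real (q x)) \<xi>" for \<xi>
      using eq[of \<xi>] by (simp add: fourier_transform_def p_def q_def)
    then have "char (density lborel (\<lambda>x. ennreal (p x))) = char (density lborel (\<lambda>x. ennreal (q x)))"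
      using p q by (intro ext) (simp add: fourier_transform_eq_char)
    then have "density lborel (\<lambda>x. ennreal (p x)) = density lborel (\<lambda>x. ennreal (q x))"
      by (intro Levy_uniqueness real_distribution_density p q)
    then have "AE x in lborel. ennreal (p x) = ennreal (q x)"
      by (intro sigma_finite_measure.density_unique sigma_finite_lborel) auto
    then show ?thesis
      by eventually_elim (use \<open>I > 0\<close> p(2) q(2) in \<open>auto simp: p_def q_def\<close>)
  qed
qed

lemma fourier_transform_unique:
  fixes f g :: "real \<Rightarrow> real"
  assumes f: "integrable lborel f" and g: "integrable lborel g"
    and eq: "\<And>\<xi>. fourier_transform (\<lambda>x. of_real (f x)) \<xi> = fourier_transform (\<lambda>x. of_real (g x)) \<xi>"
  shows "AE x in lborel. f x = g x"
proof -
  \<comment> \<open>The positive part of each function is paired with the negative part of the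
    other. Both sums are nonnegative and \<open>p - q = f - g\<close>, so by linearity
    \<open>p\<close> and \<open>q\<close> have equal transforms.\<close>
  define p q where "p = (\<lambda>x. max (f x) 0 + max (- g x) 0)" and "q = (\<lambda>x. max (g x) 0 + max (- f x) 0)"
  have p: "integrable lborel p" "\<And>x. 0 \<le> p x" and q: "integrable lborel q" "\<And>x. 0 \<le> q x"
    using f g by (auto simp: p_def q_def)
  have pq: "p x - q x = f x - g x" for x
    by (auto simp: p_def q_def)
  have "AE x in lborel. p x = q x"
  proof (rule fourier_transform_unique_nonneg[OF p q])
    fix \<xi>
    show "fourier_transform (\<lambda>x. of_real (p x)) \<xi> = fourier_transform (\<lambda>x. of_real (q x)) \<xi>"
      using fourier_transform_of_real_diff[OF p(1) q(1), of \<xi>]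
        fourier_transform_of_real_diff[OF f g, of \<xi>] eq[of \<xi>] by (simp only: pq) simp
  qed
  then show ?thesis
    by eventually_elim (metis pq diff_self eq_iff_diff_eq_0)
qed

section \<open>Evenness of the kernel\<close>

lemma fourier_transform_reflect:
  "fourier_transform (\<lambda>x. f (- x)) \<xi> = fourier_transform f (- \<xi>)"
  unfolding fourier_transform_def
  by (subst lborel_integral_real_affine[where c = "-1" and t = 0]) auto

lemma whitham_symbol_minus: "whitham_symbol (- \<xi>) = whitham_symbol \<xi>"
  by (simp add: whitham_symbol_def)

text \<open>Reflecting \<open>K\<close> reflects its transform, and the symbol is even, so
  \<open>K\<close> and its reflection have the same transform.\<close>

lemma whitham_kernel_even:
  assumes "whitham_kernel K"
  shows "AE x in lborel. K (- x) = K x"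
proof (rule fourier_transform_unique)
  show K: "integrable lborel K"
    using assms by (simp add: whitham_kernel_def)
  show "integrable lborel (\<lambda>x. K (- x))"
    using lborel_integrable_real_affine[OF K, of "-1" 0] by simp
  show "fourier_transform (\<lambda>x. complex_of_real (K (- x))) \<xi> =
      fourier_transform (\<lambda>x. complex_of_real (K x)) \<xi>" for \<xi>
    using assms fourier_transform_reflect[of "\<lambda>x. complex_of_real (K x)" \<xi>]
    by (simp add: whitham_kernel_def whitham_symbol_minus)
qed

section \<open>Convolution under translation and reflection\<close>

lemma convolution_translate:
  "convolution K (\<lambda>y. w (y - a)) x = convolution K w (x - a)"
  unfolding convolution_def
  by (subst lborel_integral_real_affine[where c = 1 and t = a]) (auto simp: algebra_simps)

lemma convolution_exists_at_translate:
  "convolution_exists_at K (\<lambda>y. w (y - a)) x \<longleftrightarrow> convolution_exists_at K w (x - a)"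
  unfolding convolution_exists_at_def
  by (subst lborel_integrable_real_affine_iff[where c = 1 and t = a, symmetric])
    (auto simp: algebra_simps)

text \<open>The substitution \<open>y \<mapsto> a - y\<close> turns the kernel factor into
  \<open>K (y - x)\<close>, which evenness replaces by \<open>K (x - y)\<close>, while
  \<open>w\<close> contributes the sign.\<close>

lemma convolution_even_odd:
  assumes K: "K \<in> borel_measurable borel" "AE x in lborel. K (- x) = K x"
    and w: "w \<in> borel_measurable borel" "\<And>y. w (a - y) = - w y"
  shows "convolution K w (a - x) = - convolution K w x"
proof -
  note [measurable] = K(1) w(1)
  \<comment> \<open>Evenness holds only up to a null set, so it has to be carried along the affine
    map \<open>y \<mapsto> x - y\<close>, under which null sets pull back to null sets.\<close>
  have "AE y in lborel. K (- (x + (-1) * y)) = K (x + (-1) * y)"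
    by (rule AE_borel_affine[OF _ _ K(2)]) auto
  then have ae: "AE y in lborel. K (y - x) = K (x - y)" by simp
  have "convolution K w (a - x) = (\<integral>y. K (y - x) * w (a - y) \<partial>lborel)"
    unfolding convolution_def
    by (subst lborel_integral_real_affine[where c = "-1" and t = a]) (auto simp: algebra_simps)
  also have "\<dots> = (\<integral>y. - (K (x - y) * w y) \<partial>lborel)"
    by (rule integral_cong_AE) (use ae w(2) in auto)
  also have "\<dots> = - convolution K w x"
    by (simp add: convolution_def)
  finally show ?thesis .
qed

section \<open>Partial derivatives on the closed half-plane\<close>

lemma at_within_atLeast_neq_bot: "t \<in> {0..} \<Longrightarrow> at (t::real) within {0..} \<noteq> bot"
  using islimpt_subset[of t "{t..t + 1}" "{0..}"] by (auto simp: trivial_limit_within)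

lemma has_derivative_imp_has_vector_derivative:
  assumes "(f has_derivative f') F"
  shows "(f has_vector_derivative f' 1) F"
proof -
  have "f' h = h *\<^sub>R f' 1" for h
    using linear_scale[OF has_derivative_linear[OF assms], of h 1] by simp
  then have "f' = (\<lambda>h. h *\<^sub>R f' 1)" ..
  with assms show ?thesis
    unfolding has_vector_derivative_def by (rule back_subst[where P = "\<lambda>g. (f has_derivative g) F"])
qed

text \<open>Chain rule along the coordinate lines through \<open>(t, x)\<close>. The time derivative
  is one-sided at \<open>t = 0\<close>; it is well defined since \<open>t\<close> is a limit point
  of \<open>{0..}\<close>.\<close>

lemma partial_derivatives:
  fixes u :: "real \<times> real \<Rightarrow> real" and D :: "real \<times> real \<Rightarrow> (real \<times> real) \<Rightarrow>\<^sub>L real"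
  assumes D: "\<And>z. z \<in> {0..} \<times> UNIV \<Longrightarrow> (u has_derivative D z) (at z within {0..} \<times> UNIV)"
    and t: "t \<ge> 0"
  shows time_deriv_eq: "time_deriv u t x = D (t, x) (1, 0)"
    and space_deriv_eq: "space_deriv u t x = D (t, x) (0, 1)"
proof -
  have "((\<lambda>s. u (s, x)) has_derivative (\<lambda>h. D (t, x) (h, 0))) (at t within {0..})"
    using t by (intro has_derivative_in_compose2[OF D]) (auto intro!: derivative_eq_intros)
  from has_derivative_imp_has_vector_derivative[OF this]
  have "((\<lambda>s. u (s, x)) has_vector_derivative D (t, x) (1, 0)) (at t within {0..})" .
  then show "time_deriv u t x = D (t, x) (1, 0)"
    unfolding time_deriv_def using t by (intro vector_derivative_within at_within_atLeast_neq_bot) auto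
  have "((\<lambda>y. u (t, y)) has_derivative (\<lambda>h. D (t, x) (0, h))) (at x)"
    using t by (intro has_derivative_in_compose2[OF D]) (auto intro!: derivative_eq_intros)
  from has_derivative_imp_has_vector_derivative[OF this]
  have "((\<lambda>y. u (t, y)) has_field_derivative D (t, x) (0, 1)) (at x)"
    by (simp only: has_real_derivative_iff_has_vector_derivative)
  then show "space_deriv u t x = D (t, x) (0, 1)"
    unfolding space_deriv_def by (rule DERIV_imp_deriv)
qed

text \<open>Both identities come from differentiating the symmetry relation at time 0, once in space
  and once in time; the motion of the axis \<open>l\<close> produces the term with
  \<open>c\<close>.\<close>

lemma symmetric_derivatives:
  fixes u :: "real \<times> real \<Rightarrow> real"
  assumes u: "C1_on ({0..} \<times> UNIV) u" and l: "(l has_vector_derivative c) (at 0 within {0..})"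
    and sym: "\<And>t x. t \<ge> 0 \<Longrightarrow> u (t, x) = u (t, 2 * l t - x)"
  shows "space_deriv u 0 (2 * l 0 - x) = - space_deriv u 0 x"
    and "time_deriv u 0 (2 * l 0 - x) = time_deriv u 0 x + 2 * c * space_deriv u 0 x"
proof -
  obtain D where D: "\<And>z. z \<in> {0..} \<times> UNIV \<Longrightarrow> (u has_derivative blinfun_apply (D z)) (at z within {0..} \<times> UNIV)"
    using u unfolding C1_on_def by blast
  note td = time_deriv_eq[OF D order.refl] and sd = space_deriv_eq[OF D order.refl]
  let ?y = "2 * l 0 - x"
  have "((\<lambda>z. u (0, 2 * l 0 - z)) has_derivative (\<lambda>h. D (0, ?y) (0, - h))) (at x)"
    by (intro has_derivative_in_compose2[OF D]) (auto intro!: derivative_eq_intros)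
  \<comment> \<open>By symmetry the reflected profile is the profile itself, so its two derivatives
    at \<open>x\<close> must coincide.\<close>
  then have "((\<lambda>z. u (0, z)) has_derivative (\<lambda>h. D (0, ?y) (0, - h))) (at x)"
    by (simp only: sym[OF order.refl, symmetric])
  moreover have "((\<lambda>z. u (0, z)) has_derivative (\<lambda>h. D (0, x) (0, h))) (at x)"
    by (intro has_derivative_in_compose2[OF D]) (auto intro!: derivative_eq_intros)
  ultimately have "(\<lambda>h. D (0, ?y) (0, - h)) = (\<lambda>h. D (0, x) (0, h))"
    by (rule has_derivative_unique)
  then have "D (0, ?y) (0, - 1) = D (0, x) (0, 1)"
    by (rule fun_cong)
  moreover have "D (0, ?y) (0, - 1) = - D (0, ?y) (0, 1)"
    using blinfun.minus_right[of "D (0, ?y)" "(0, 1)"] by simp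
  ultimately show space: "space_deriv u 0 ?y = - space_deriv u 0 x"
    by (simp add: sd)
  have "((\<lambda>t. u (t, 2 * l t - x)) has_derivative (\<lambda>h. D (0, ?y) (h, 2 * (h * c)))) (at 0 within {0..})"
    using l unfolding has_vector_derivative_def
    by (intro has_derivative_in_compose2[OF D]) (auto intro!: derivative_eq_intros)
  from has_derivative_imp_has_vector_derivative[OF this]
  have "((\<lambda>t. u (t, 2 * l t - x)) has_vector_derivative D (0, ?y) (1, 2 * c)) (at 0 within {0..})"
    by simp
  \<comment> \<open>The symmetry relation is available for \<open>t \<ge> 0\<close> only, which
    suffices for a derivative within \<open>{0..}\<close>.\<close>
  then have "((\<lambda>t. u (t, x)) has_vector_derivative D (0, ?y) (1, 2 * c)) (at 0 within {0..})"
    by (rule has_vector_derivative_transform[rotated 2]) (simp_all flip: sym)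
  then have "time_deriv u 0 x = D (0, ?y) (1, 2 * c)"
    unfolding time_deriv_def by (intro vector_derivative_within at_within_atLeast_neq_bot) auto
  also have "\<dots> = D (0, ?y) ((1, 0) + (2 * c) *\<^sub>R (0, 1))"
    by simp
  also have "\<dots> = time_deriv u 0 ?y + 2 * c * space_deriv u 0 ?y"
    by (simp only: blinfun.add_right blinfun.scaleR_right td sd real_scaleR_def)
  finally show "time_deriv u 0 ?y = time_deriv u 0 x + 2 * c * space_deriv u 0 x"
    using space by simp
qed

text \<open>The wave \<open>v\<close> is \<open>u\<close> composed with a linear map into the line
  \<open>t = 0\<close>, so everything follows from the chain rule.\<close>

lemma C1_on_traveling_wave:
  fixes u :: "real \<times> real \<Rightarrow> real" and c :: real
  assumes "C1_on ({0..} \<times> UNIV) u"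
  defines "v \<equiv> \<lambda>z. u (0, snd z - c * fst z)"
  shows "C1_on ({0..} \<times> UNIV) v"
    and "t \<ge> 0 \<Longrightarrow> time_deriv v t x = - c * space_deriv u 0 (x - c * t)"
    and "t \<ge> 0 \<Longrightarrow> space_deriv v t x = space_deriv u 0 (x - c * t)"
proof -
  obtain D where D: "\<And>z. z \<in> {0..} \<times> UNIV \<Longrightarrow> (u has_derivative blinfun_apply (D z)) (at z within {0..} \<times> UNIV)"
    and contD: "continuous_on ({0..} \<times> UNIV) D"
    using assms unfolding C1_on_def by blast
  \<comment> \<open>Writing the inner linear map as a bounded linear function makes the derivative
    \<open>E\<close> of \<open>v\<close> a composition in operator space, whose continuity is
    inherited from \<open>D\<close>.\<close>
  define L :: "(real \<times> real) \<Rightarrow>\<^sub>L (real \<times> real)" where "L = Blinfun (\<lambda>h. (0, snd h - c * fst h))"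
  have L: "L h = (0, snd h - c * fst h)" for h
    unfolding L_def
    by (subst bounded_linear_Blinfun_apply) (auto intro!: bounded_linear_intros)
  define E where "E = (\<lambda>z. D (0, snd z - c * fst z) o\<^sub>L L)"
  have E: "(v has_derivative E z) (at z within {0..} \<times> UNIV)" if "z \<in> {0..} \<times> UNIV" for z
  proof -
    have "((\<lambda>z. u (0, snd z - c * fst z)) has_derivative
        (\<lambda>h. D (0, snd z - c * fst z) (0, snd h - c * fst h))) (at z within {0..} \<times> UNIV)"
      using that by (intro has_derivative_in_compose2[OF D]) (auto intro!: derivative_eq_intros)
    moreover have "blinfun_apply (E z) = (\<lambda>h. D (0, snd z - c * fst z) (0, snd h - c * fst h))"
      by (rule ext) (simp add: E_def L)
    ultimately show ?thesis by (simp add: v_def)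
  qed
  have "continuous_on ({0..} \<times> UNIV) E"
    unfolding E_def
    by (intro continuous_intros continuous_on_compose2[OF contD]) auto
  with E show "C1_on ({0..} \<times> UNIV) v"
    unfolding C1_on_def by blast
  have sd: "space_deriv u 0 y = D (0, y) (0, 1)" for y
    by (rule space_deriv_eq[OF D]) auto
  show "space_deriv v t x = space_deriv u 0 (x - c * t)" if "t \<ge> 0"
    using space_deriv_eq[OF E that] by (simp add: sd E_def L)
  have "D z (0, - c) = - c * D z (0, 1)" for z
    using blinfun.scaleR_right[of "D z" "- c" "(0, 1)"] by simp
  then show "time_deriv v t x = - c * space_deriv u 0 (x - c * t)" if "t \<ge> 0"
    using time_deriv_eq[OF E that] by (simp add: sd E_def L)
qed

lemma continuous_on_space_deriv:
  assumes "C1_on ({0..} \<times> UNIV) u" "t \<ge> 0"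
  shows "continuous_on UNIV (space_deriv u t)"
proof -
  obtain D where D: "\<And>z. z \<in> {0..} \<times> UNIV \<Longrightarrow> (u has_derivative blinfun_apply (D z)) (at z within {0..} \<times> UNIV)"
    and contD: "continuous_on ({0..} \<times> UNIV) D"
    using assms unfolding C1_on_def by blast
  have "space_deriv u t = (\<lambda>x. D (t, x) (0, 1))"
    using space_deriv_eq[OF D \<open>t \<ge> 0\<close>] by blast
  then show ?thesis
    using \<open>t \<ge> 0\<close> by (auto intro!: continuous_intros continuous_on_compose2[OF contD])
qed

theorem theorem5p1:
  fixes K :: "real \<Rightarrow> real" and u :: "real \<times> real \<Rightarrow> real"
  assumes kernel: "whitham_kernel K"
    and solution: "classical_solution K u"
    and symmetric: "\<exists>l :: real \<Rightarrow> real. C1_on {0..} l \<and>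
          (\<forall>t\<ge>0. \<forall>x. u (t, x) = u (t, 2 * l t - x))"
    and unique: "\<And>v. classical_solution K v \<Longrightarrow> (\<forall>x. v (0, x) = u (0, x)) \<Longrightarrow>
          (\<forall>t\<ge>0. \<forall>x. v (t, x) = u (t, x))"
  shows "\<exists>(c :: real) (\<phi> :: real \<Rightarrow> real). \<forall>t\<ge>0. \<forall>x. u (t, x) = \<phi> (x - c * t)"
proof -
  obtain l :: "real \<Rightarrow> real" where "C1_on {0..} l"
    and sym: "\<And>t x. t \<ge> 0 \<Longrightarrow> u (t, x) = u (t, 2 * l t - x)"
    using symmetric by blast
  then obtain D :: "real \<Rightarrow> real \<Rightarrow>\<^sub>L real" where "(l has_derivative D 0) (at 0 within {0..})"
    unfolding C1_on_def by auto
  \<comment> \<open>The wave speed \<open>c\<close> is the initial velocity of the symmetry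
    axis.\<close>
  from has_derivative_imp_has_vector_derivative[OF this]
  obtain c where l: "(l has_vector_derivative c) (at 0 within {0..})" ..
  have C1: "C1_on ({0..} \<times> UNIV) u"
    and conv: "\<And>x. convolution_exists_at K (space_deriv u 0) x"
    and pde: "\<And>x. time_deriv u 0 x + 2 * u (0, x) * space_deriv u 0 x
        + convolution K (space_deriv u 0) x = 0"
    using solution by (auto simp: classical_solution_def)
  note sd = symmetric_derivatives[OF C1 l sym]
  have profile: "2 * u (0, x) * space_deriv u 0 x + convolution K (space_deriv u 0) x
      = c * space_deriv u 0 x" for x
  proof -
    have "convolution K (space_deriv u 0) (2 * l 0 - x) = - convolution K (space_deriv u 0) x"
      using kernel whitham_kernel_even[OF kernel] continuous_on_space_deriv[OF C1] sd(1)
      by (intro convolution_even_odd) (auto simp: whitham_kernel_def intro: borel_measurable_continuous_onI)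
    then show ?thesis
      \<comment> \<open>Subtract the equation at the reflected point from the equation at
        \<open>x\<close>: the time derivatives cancel up to
        \<open>2 * c * space_deriv u 0 x\<close>, the two odd terms double, and halving gives the
        claim.\<close>
      using pde[of x] pde[of "2 * l 0 - x"] sd[of x] sym[of 0 x] by (simp add: algebra_simps)
  qed
  define v where "v = (\<lambda>z. u (0, snd z - c * fst z))"
  then have v_eq: "v (t, x) = u (0, x - c * t)" for t x
    by simp
  note wave = C1_on_traveling_wave[OF C1, where c = c, folded v_def]
  have space: "space_deriv v t = (\<lambda>y. space_deriv u 0 (y - c * t))" if "t \<ge> 0" for t
    using wave(3)[OF that] by blast
  have "classical_solution K v"
    unfolding classical_solution_def
  proof (intro conjI allI impI)
    fix t x :: real
    assume t: "t \<ge> 0"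
    show "convolution_exists_at K (space_deriv v t) x"
      using conv by (simp add: space[OF t] convolution_exists_at_translate)
    show "time_deriv v t x + 2 * v (t, x) * space_deriv v t x + convolution K (space_deriv v t) x = 0"
      \<comment> \<open>For \<open>v\<close> the time derivative is \<open>- c\<close> times the
        space derivative, so the equation at \<open>(t, x)\<close> is the profile equation at
        \<open>x - c * t\<close>.\<close>
      using profile[of "x - c * t"] wave(2)[OF t, of x]
      by (simp add: space[OF t] convolution_translate v_eq)
  qed (fact wave(1))
  then have "\<forall>t\<ge>0. \<forall>x. v (t, x) = u (t, x)"
    by (rule unique) (simp add: v_def)
  then have "\<forall>t\<ge>0. \<forall>x. u (t, x) = u (0, x - c * t)"
    by (metis v_eq)
  then show ?thesis
    by (intro exI[of _ c] exI[of _ "\<lambda>x. u (0, x)"])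
qed

end
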